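(* Let $R>0$ and $0<w<R$ be fixed real numbers, and let $$\gamma:[0,2\pi)\times[-w,w]\to\mathbb{R}^3,\qquad \gamma(r,s)=\left(\left[R+s\cos\tfrac r2\right]\cos r,\ \left[R+s\cos\tfrac r2\right]\sin r,\ s\sin\tfrac r2\right).$$ Let $\mathcal{M}=\gamma\left([0,2\pi)\times[-w,w]\right)\subseteq\mathbb{R}^3=\mathbb{H}^1$ be the Möbius strip parametrised by $\gamma$. Then $\mathcal{M}$ contains at most one characteristic point $\tilde p$, and so there exists a $1$-codimensional $C^1$-Euclidean surface $\widetilde{\mathcal{M}}\subseteq\mathcal{M}$ such that $\tilde p\notin\widetilde{\mathcal{M}}$ (if such a point $\tilde p$ exists), $\widetilde{\mathcal{M}}$ is still not Euclidean-orientable, and $C(\widetilde{\mathcal{M}})=\varnothing$.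
   Context: The Heisenberg group $\mathbb{H}^1$ is $\mathbb{R}^3$ with coordinates $(x,y,t)$ and group product $(x,y,t)*(x',y',t')=(x+x',y+y',t+t'+\frac12(xy'-yx'))$. Its standard left invariant vector fields are $X=\partial_x-\frac12 y\,\partial_t$, $Y=\partial_y+\frac12 x\,\partial_t$, $T=\partial_t$. The horizontal space at $p$ is $\mathfrak{h}_{1,p}=\operatorname{span}\{X_p,Y_p\}$. A $1$-codimensional $C^1$-Euclidean surface $S\subseteq\mathbb{H}^1$ is a subset such that for every $p\in S$ there are an open neighbourhood $U$ of $p$ and $g\in C^1(U,\mathbb{R})$ (ordinary Euclidean $C^1$) with $S\cap U=\{g=0\}$ and $\nabla g\neq0$ on $U$ ($\nabla$ the Euclidean gradient). The characteristic set of a surface $S$ is $C(S)=\{p\in S:\ T_pS\subseteq\mathfrak{h}_{1,p}\}$, where $T_pS$ is the tangent space of $S$ at $p$; its elements are called characteristic points. For $\mathcal{M}$, the tangent space at $\gamma(r,s)$ is spanned by $\partial_r\gamma(r,s)$ and $\partial_s\gamma(r,s)$. A $1$-codimensional $C^1$-Euclidean surface $S$ with $C(S)=\varnothing$ is Euclidean-orientable if there is a continuous nowhere zero vector field $n_E=n_{E,1}\partial_x+n_{E,2}\partial_y+n_{E,3}\partial_t$ defined on all of $S$ and normal to $S$, i.e. orthogonal to $T_pS$ at every $p\in S$ with respect to the Euclidean inner product of $\mathbb{R}^3$. *)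

theory Defs
  imports "HOL-Analysis.Analysis"
begin

text \<open>
  Points of the Heisenberg group and tangent vectors at them both have type \<open>real ^ 3\<close>;
  a tangent vector is given by its components with respect to
  \<open>\<partial>\<^sub>x\<close>, \<open>\<partial>\<^sub>y\<close>, \<open>\<partial>\<^sub>t\<close>.
\<close>

definition heis_X :: "real ^ 3 \<Rightarrow> real ^ 3" where
  "heis_X p = vector [1, 0, - (1 / 2) * p $ 2]"

definition heis_Y :: "real ^ 3 \<Rightarrow> real ^ 3" where
  "heis_Y p = vector [0, 1, (1 / 2) * p $ 1]"

definition horizontal_space :: "real ^ 3 \<Rightarrow> (real ^ 3) set" where
  "horizontal_space p = span {heis_X p, heis_Y p}"

definition C1_euclidean_surface :: "(real ^ 3) set \<Rightarrow> bool" where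
  "C1_euclidean_surface S \<longleftrightarrow>
     (\<forall>p\<in>S. \<exists>U g G. open U \<and> p \<in> U \<and>
        (\<forall>q\<in>U. GDERIV g q :> G q) \<and> continuous_on U G \<and>
        S \<inter> U = {q \<in> U. g q = 0} \<and>
        (\<forall>q\<in>U. G q \<noteq> 0))"

text \<open>The tangent space as the set of velocities of \<open>C\<^sup>1\<close> curves in \<open>S\<close> through \<open>p\<close>.\<close>

definition tangent_space :: "(real ^ 3) set \<Rightarrow> real ^ 3 \<Rightarrow> (real ^ 3) set" where
  "tangent_space S p =
     {v. \<exists>(e::real) c c'. e > 0 \<and>
        (\<forall>u\<in>{-e<..<e}. c u \<in> S \<and> (c has_vector_derivative c' u) (at u)) \<and>
        continuous_on {-e<..<e} c' \<and> c 0 = p \<and> c' 0 = v}"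

text \<open>
  The assignment \<open>\<T>\<close> of tangent spaces is a parameter because the Moebius strip below has a
  boundary, where curves inside the strip do not have all tangent vectors as velocities.
\<close>

definition characteristic_set ::
  "(real ^ 3 \<Rightarrow> (real ^ 3) set) \<Rightarrow> (real ^ 3) set \<Rightarrow> (real ^ 3) set" where
  "characteristic_set \<T> S = {p \<in> S. \<T> p \<subseteq> horizontal_space p}"

text \<open>Meant for \<open>C\<^sup>1\<close> surfaces without characteristic points; these conditions are not part of the
  definition, so that its negation has no vacuous instances.\<close>

definition euclidean_orientable :: "(real ^ 3) set \<Rightarrow> bool" where
  "euclidean_orientable S \<longleftrightarrow>
     (\<exists>n :: real ^ 3 \<Rightarrow> real ^ 3. continuous_on S n \<and>
        (\<forall>p\<in>S. n p \<noteq> 0 \<and> (\<forall>v\<in>tangent_space S p. n p \<bullet> v = 0)))"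

definition mobius_param :: "real \<Rightarrow> real \<Rightarrow> real \<Rightarrow> real ^ 3" where
  "mobius_param R r s =
     vector [(R + s * cos (r / 2)) * cos r, (R + s * cos (r / 2)) * sin r, s * sin (r / 2)]"

definition mobius_strip :: "real \<Rightarrow> real \<Rightarrow> (real ^ 3) set" where
  "mobius_strip R w = (\<lambda>(r, s). mobius_param R r s) ` ({0..<2 * pi} \<times> {-w..w})"

text \<open>
  The union below is over the parameters of \<open>p\<close>; by \<open>inj_on_mobius_param\<close> there is exactly one
  such pair for each point of the strip, see \<open>mobius_tangent_space_param\<close>.
\<close>

definition mobius_tangent_space :: "real \<Rightarrow> real \<Rightarrow> real ^ 3 \<Rightarrow> (real ^ 3) set" where
  "mobius_tangent_space R w p =
     (\<Union>(r, s) \<in> {(r, s) \<in> {0..<2 * pi} \<times> {-w..w}. mobius_param R r s = p}.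
        span {vector_derivative (\<lambda>r'. mobius_param R r' s) (at r within {0..<2 * pi}),
              vector_derivative (\<lambda>s'. mobius_param R r s') (at s within {-w..w})})"

lemma inj_on_mobius_param:
  assumes "0 < w" "w < R"
  shows "inj_on (\<lambda>(r, s). mobius_param R r s) ({0..<2 * pi} \<times> {-w..w})"
proof -
  have "r = r' \<and> s = s'"
    if r: "0 \<le> r" "r < 2 * pi" "0 \<le> r'" "r' < 2 * pi"
      and s: "\<bar>s\<bar> \<le> w" "\<bar>s'\<bar> \<le> w"
      and eq: "mobius_param R r s = mobius_param R r' s'" for r s r' s'
  proof -
    define a where "a = R + s * cos (r / 2)"
    define b where "b = R + s' * cos (r' / 2)"
    have bound: "\<bar>u * cos v\<bar> \<le> w" if "\<bar>u\<bar> \<le> w" for u v :: real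
      using mult_mono[OF that abs_cos_le_one[of v]] assms by (simp add: abs_mult)
    have pos: "a > 0" "b > 0"
      using bound[OF s(1), of "r / 2"] bound[OF s(2), of "r' / 2"] assms
      by (auto simp: a_def b_def)
    have e: "a * cos r = b * cos r'" "a * sin r = b * sin r'" "s * sin (r / 2) = s' * sin (r' / 2)"
      using arg_cong[OF eq, of "\<lambda>v. v $ 1"] arg_cong[OF eq, of "\<lambda>v. v $ 2"]
        arg_cong[OF eq, of "\<lambda>v. v $ 3"]
      by (simp_all add: mobius_param_def a_def b_def)
    have norm: "(c * cos t)\<^sup>2 + (c * sin t)\<^sup>2 = c\<^sup>2" for c t :: real
      by (simp add: power_mult_distrib flip: distrib_left)
    have "a\<^sup>2 = b\<^sup>2"
      using norm[of a r] norm[of b r'] e by simp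
    then have ab: "a = b"
      using pos by (simp add: power2_eq_iff)
    then have "sin r = sin r' \<and> cos r = cos r'"
      using e pos by simp
    then obtain n :: int where n: "r = r' + 2 * pi * n"
      using sin_cos_eq_iff by blast
    have "2 * pi * \<bar>real_of_int n\<bar> < 2 * pi * 1"
    proof -
      have "2 * pi * \<bar>real_of_int n\<bar> = \<bar>r - r'\<bar>"
        using n by (simp add: abs_mult)
      then show ?thesis using r by linarith
    qed
    then have "n = 0"
      by simp
    then have rr: "r = r'"
      using n by simp
    have "s * cos (r / 2) = s' * cos (r / 2)" "s * sin (r / 2) = s' * sin (r / 2)"
      using ab e rr by (simp_all add: a_def b_def)
    moreover have "cos (r / 2) \<noteq> 0 \<or> sin (r / 2) \<noteq> 0"
      using sin_cos_squared_add[of "r / 2"] by (metis power_zero_numeral add_0 zero_neq_one)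
    ultimately show ?thesis
      using rr by auto
  qed
  note * = this
  show ?thesis
  proof (rule inj_onI, clarify)
    fix r s r' s'
    assume "r \<in> {0..<2 * pi}" "s \<in> {-w..w}" "r' \<in> {0..<2 * pi}" "s' \<in> {-w..w}"
      and "mobius_param R r s = mobius_param R r' s'"
    then show "r = r' \<and> s = s'"
      using *[of r r' s s'] by (simp add: abs_le_iff)
  qed
qed

lemma mobius_tangent_space_param:
  assumes "0 < w" "w < R" "r \<in> {0..<2 * pi}" "s \<in> {-w..w}"
  shows "mobius_tangent_space R w (mobius_param R r s) =
     span {vector_derivative (\<lambda>r'. mobius_param R r' s) (at r within {0..<2 * pi}),
           vector_derivative (\<lambda>s'. mobius_param R r s') (at s within {-w..w})}"
proof -
  have "{(r', s') \<in> {0..<2 * pi} \<times> {-w..w}. mobius_param R r' s' = mobius_param R r s} = {(r, s)}"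
    using inj_onD[OF inj_on_mobius_param[OF assms(1,2)], of _ "(r, s)"] assms(3,4) by auto
  then show ?thesis
    unfolding mobius_tangent_space_def by simp
qed

end

theory Submission
  imports Defs
begin

text \<open>
  A point \<open>\<gamma>(r, s)\<close> is characteristic iff \<open>\<gamma>\<^sub>s\<close> and \<open>\<gamma>\<^sub>r\<close> are horizontal. The first condition
  reads \<open>sin (r / 2) = 0\<close>, so \<open>r = 0\<close>, and the second one then reads \<open>s = (R + s)\<^sup>2\<close>. The product of
  the roots of this quadratic equation is \<open>R\<^sup>2\<close>, so at most one of them lies in \<open>[-w, w]\<close>; moreover no
  root lies in \<open>(-v, v)\<close> if \<open>v \<le> (R - w)\<^sup>2\<close>. Hence the open band \<open>\<bar>s\<bar> < v\<close> has no characteristic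
  points. In cylindrical coordinates \<open>(\<rho>, \<theta>, t)\<close> it is given by
  \<open>(\<rho> - R) sin (\<theta> / 2) = t cos (\<theta> / 2)\<close> inside a solid torus, and \<open>tan (\<theta> / 2) = y / (\<rho> + x)\<close> and
  \<open>cot (\<theta> / 2) = y / (\<rho> - x)\<close> turn this into two \<open>C\<^sup>1\<close> local equations. A continuous
  nowhere zero normal would have a nowhere zero inner product with the unit normal
  \<open>(sin (r / 2) cos r, sin (r / 2) sin r, - cos (r / 2))\<close> along the core circle, which changes sign
  as \<open>r\<close> runs from \<open>0\<close> to \<open>2\<pi>\<close>.
\<close>

section \<open>Coordinates in \<open>real ^ 3\<close> and horizontal vectors\<close>

lemma vec3_eqI:
  fixes v u :: "real ^ 3"
  assumes "v $ 1 = u $ 1" "v $ 2 = u $ 2" "v $ 3 = u $ 3"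
  shows "v = u"
  using assms by (simp add: vec_eq_iff forall_3)

lemma inner_vec3: "(v :: real ^ 3) \<bullet> u = v $ 1 * u $ 1 + v $ 2 * u $ 2 + v $ 3 * u $ 3"
  by (simp add: inner_vec_def sum_3)

text \<open>Reduces calculus for \<open>vector\<close> to the rules for sums of scaled constant
  vectors.\<close>

lemma vector3_as_sum:
  "(vector [a, b, c] :: real ^ 3) = a *\<^sub>R axis 1 1 + b *\<^sub>R axis 2 1 + c *\<^sub>R axis 3 1"
  by (rule vec3_eqI) (simp_all add: axis_def)

lemma continuous_on_vector3 [continuous_intros]:
  fixes f g h :: "'a :: topological_space \<Rightarrow> real"
  assumes "continuous_on S f" "continuous_on S g" "continuous_on S h"
  shows "continuous_on S (\<lambda>q. vector [f q, g q, h q] :: real ^ 3)"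
  unfolding vector3_as_sum by (intro continuous_intros assms)

lemma has_vector_derivative_vector3:
  assumes "(f has_real_derivative f') F" "(g has_real_derivative g') F"
    "(h has_real_derivative h') F"
  shows "((\<lambda>u. vector [f u, g u, h u] :: real ^ 3) has_vector_derivative vector [f', g', h']) F"
  unfolding vector3_as_sum
  using assms unfolding has_real_derivative_iff_has_vector_derivative
  by (intro has_vector_derivative_add
      bounded_linear.has_vector_derivative[OF bounded_linear_scaleR_left])

text \<open>The contact form \<open>dt - (x dy - y dx) / 2\<close> annihilates horizontal vectors:
  its kernel is a subspace containing both generators.\<close>

lemma horizontal_spaceD:
  assumes "v \<in> horizontal_space p"
  shows "2 * v $ 3 = p $ 1 * v $ 2 - p $ 2 * v $ 1"
proof -
  let ?H = "{v :: real ^ 3. 2 * v $ 3 = p $ 1 * v $ 2 - p $ 2 * v $ 1}"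
  have "subspace ?H"
  proof (rule subspaceI)
    fix c and x :: "real ^ 3" assume "x \<in> ?H"
    then have "c * (2 * x $ 3) = c * (p $ 1 * x $ 2 - p $ 2 * x $ 1)"
      by simp
    then show "c *\<^sub>R x \<in> ?H"
      by (simp add: algebra_simps)
  qed (auto simp: algebra_simps)
  moreover have "{heis_X p, heis_Y p} \<subseteq> ?H"
    by (simp add: heis_X_def heis_Y_def)
  ultimately have "horizontal_space p \<subseteq> ?H"
    unfolding horizontal_space_def by (rule span_minimal[rotated])
  then show ?thesis
    using assms by blast
qed

section \<open>Velocities of the parametrisation and characteristic points of the strip\<close>

definition mobius_dr :: "real \<Rightarrow> real \<Rightarrow> real \<Rightarrow> real ^ 3" where
  "mobius_dr R r s =
     vector [- (s / 2) * sin (r / 2) * cos r - (R + s * cos (r / 2)) * sin r,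
             - (s / 2) * sin (r / 2) * sin r + (R + s * cos (r / 2)) * cos r,
             (s / 2) * cos (r / 2)]"

definition mobius_ds :: "real \<Rightarrow> real ^ 3" where
  "mobius_ds r = vector [cos (r / 2) * cos r, cos (r / 2) * sin r, sin (r / 2)]"

lemma mobius_param_has_derivative_r:
  "((\<lambda>r. mobius_param R r s) has_vector_derivative mobius_dr R r s) (at r within A)"
  unfolding mobius_param_def mobius_dr_def
  by (rule has_vector_derivative_vector3) (auto intro!: derivative_eq_intros)

lemma mobius_param_has_derivative_s:
  "((\<lambda>s. mobius_param R r s) has_vector_derivative mobius_ds r) (at s within A)"
  unfolding mobius_param_def mobius_ds_def
  by (rule has_vector_derivative_vector3) (auto intro!: derivative_eq_intros)

text \<open>A derivative within a set determines \<open>vector_derivative\<close> only at limit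
  points of that set; the second point \<open>y\<close> makes \<open>x\<close> one.\<close>

lemma connected_within_neq_bot:
  assumes "x \<in> S" "connected S" "y \<in> S" "y \<noteq> x"
  shows "at (x :: real) within S \<noteq> bot"
  using connected_imp_perfect[of S x] assms
  by (metis singletonD trivial_limit_within)

text \<open>The parametrisation is differentiable at all real parameters, so one-sided derivatives
  at the ends of the ranges obey the same formulas.\<close>

lemma mobius_tangent_space_eq:
  assumes "0 < w" "w < R" "r \<in> {0..<2 * pi}" "s \<in> {-w..w}"
  shows "mobius_tangent_space R w (mobius_param R r s) = span {mobius_dr R r s, mobius_ds r}"
proof -
  have "at r within {0..<2 * pi} \<noteq> bot"
    by (rule connected_within_neq_bot[where y = "if r = 0 then pi else 0"]) (use assms in auto)
  then have r: "vector_derivative (\<lambda>r. mobius_param R r s) (at r within {0..<2 * pi}) = mobius_dr R r s"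
    by (rule vector_derivative_within[OF _ mobius_param_has_derivative_r])
  have "at s within {-w..w} \<noteq> bot"
    by (rule connected_within_neq_bot[where y = "if s = 0 then w else 0"]) (use assms in auto)
  then have s: "vector_derivative (\<lambda>s. mobius_param R r s) (at s within {-w..w}) = mobius_ds r"
    by (rule vector_derivative_within[OF _ mobius_param_has_derivative_s])
  show ?thesis
    unfolding mobius_tangent_space_param[OF assms] r s ..
qed

text \<open>The \<open>x, y\<close> part of \<open>mobius_ds r\<close> is parallel to that of the
  position, so the contact form sees only \<open>sin (r / 2)\<close>. At \<open>r = 0\<close> the
  base point is \<open>(R + s, 0, 0)\<close> and the velocity in \<open>r\<close> is
  \<open>(0, R + s, s / 2)\<close>.\<close>

lemma mobius_horizontalD:
  assumes r: "0 \<le> r" "r < 2 * pi"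
    and "mobius_dr R r s \<in> horizontal_space (mobius_param R r s)"
    and "mobius_ds r \<in> horizontal_space (mobius_param R r s)"
  shows "r = 0" "s = (R + s)\<^sup>2"
proof -
  have "sin (r / 2) = 0"
    using horizontal_spaceD[OF assms(4)] by (simp add: mobius_ds_def mobius_param_def)
  then show r0: "r = 0"
    using sin_gt_zero[of "r / 2"] r by force
  show "s = (R + s)\<^sup>2"
    using horizontal_spaceD[OF assms(3)]
    by (simp add: r0 mobius_dr_def mobius_param_def power2_eq_square)
qed

lemma characteristic_mobius_stripE:
  assumes "0 < w" "w < R"
    and "p \<in> characteristic_set (mobius_tangent_space R w) (mobius_strip R w)"
  obtains s where "\<bar>s\<bar> \<le> w" "p = mobius_param R 0 s" "s = (R + s)\<^sup>2"
proof -
  obtain r s where rs: "r \<in> {0..<2 * pi}" "s \<in> {-w..w}" "p = mobius_param R r s"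
    using assms(3) by (auto simp: characteristic_set_def mobius_strip_def)
  have "span {mobius_dr R r s, mobius_ds r} \<subseteq> horizontal_space p"
    using assms(3) mobius_tangent_space_eq[OF assms(1,2) rs(1,2)]
    by (simp add: characteristic_set_def rs(3))
  then have "mobius_dr R r s \<in> horizontal_space p" "mobius_ds r \<in> horizontal_space p"
    using span_superset by blast+
  then have "r = 0" "s = (R + s)\<^sup>2"
    using mobius_horizontalD rs by auto
  then show ?thesis
    using that[of s] rs by auto
qed

lemma characteristic_parameter_unique:
  fixes s t :: real
  assumes "\<bar>s\<bar> \<le> w" "\<bar>t\<bar> \<le> w" "w < R" "s = (R + s)\<^sup>2" "t = (R + t)\<^sup>2"
  shows "s = t"
proof (rule ccontr)
  assume "s \<noteq> t"
  \<comment> \<open>Subtracting the two equations yields the sum of the roots; the first equation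
    then gives their product.\<close>
  have "(s - t) * (2 * R + s + t - 1) = 0"
    using assms(4,5) by (simp add: power2_eq_square algebra_simps)
  then have t: "t = 1 - 2 * R - s"
    using \<open>s \<noteq> t\<close> by simp
  have "s * t = R * R"
    using assms(4) unfolding t by (simp add: power2_eq_square algebra_simps)
  moreover have "\<bar>s\<bar> * \<bar>t\<bar> \<le> w * w"
    using assms(1,2) by (intro mult_mono) auto
  moreover have "w * w < R * R"
    using assms(1,3) by (intro mult_strict_mono') auto
  ultimately show False
    using abs_ge_self[of "s * t"] unfolding abs_mult by linarith
qed

section \<open>The open band and its tangent vectors\<close>

definition open_mobius_band :: "real \<Rightarrow> real \<Rightarrow> (real ^ 3) set" where
  "open_mobius_band R v = {mobius_param R r s | r s. \<bar>s\<bar> < v}"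

lemma mobius_param_mem_band: "\<bar>s\<bar> < v \<Longrightarrow> mobius_param R r s \<in> open_mobius_band R v"
  by (auto simp: open_mobius_band_def)

text \<open>Each turn adds pi to the half angle, which negates its sine and cosine; negating
  \<open>s\<close> compensates. This is the twist of the band.\<close>

lemma mobius_param_periodic:
  "mobius_param R (r + 2 * pi * of_int n) s = mobius_param R r (if even n then s else - s)"
proof -
  have half: "(r + 2 * pi * of_int n) / 2 = r / 2 + pi * of_int n"
    by (simp add: field_simps)
  have full: "cos (r + 2 * pi * of_int n) = cos r" "sin (r + 2 * pi * of_int n) = sin r"
    by (simp_all add: cos_add sin_add)
  show ?thesis
  proof (cases "even n")
    case True
    then obtain k where "n = 2 * k" ..
    then have "pi * of_int n = 2 * pi * of_int k"
      by simp
    then have "cos (pi * of_int n) = 1" "sin (pi * of_int n) = 0"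
      by (simp_all only: cos_int_2pin sin_int_2pin)
    then show ?thesis
      using True by (simp add: mobius_param_def half full cos_add sin_add)
  next
    case False
    then obtain k where "n = 2 * k + 1" ..
    then have "pi * of_int n = 2 * pi * of_int k + pi"
      by (simp add: algebra_simps)
    then have "cos (pi * of_int n) = - 1" "sin (pi * of_int n) = 0"
      by (simp_all add: cos_add sin_add)
    then show ?thesis
      using False by (simp add: mobius_param_def half full cos_add sin_add)
  qed
qed

lemma open_mobius_bandE:
  assumes "p \<in> open_mobius_band R v"
  obtains r s where "r \<in> {0..<2 * pi}" "\<bar>s\<bar> < v" "p = mobius_param R r s"
proof -
  obtain r s where rs: "\<bar>s\<bar> < v" "p = mobius_param R r s"
    using assms by (auto simp: open_mobius_band_def)
  define n where "n = \<lfloor>r / (2 * pi)\<rfloor>"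
  define r' where "r' = r - 2 * pi * of_int n"
  have "of_int n \<le> r / (2 * pi)" "r / (2 * pi) < of_int n + 1"
    unfolding n_def by linarith+
  then have "r' \<in> {0..<2 * pi}"
    by (simp add: r'_def field_simps)
  moreover have "p = mobius_param R r' (if even n then s else - s)"
    using mobius_param_periodic[of R r' n s] by (simp add: r'_def rs)
  ultimately show ?thesis
    using that[of r' "if even n then s else - s"] rs(1) by simp
qed

lemma open_mobius_band_subset:
  assumes "v \<le> w"
  shows "open_mobius_band R v \<subseteq> mobius_strip R w"
proof
  fix p assume "p \<in> open_mobius_band R v"
  then obtain r s where "r \<in> {0..<2 * pi}" "\<bar>s\<bar> < v" "p = mobius_param R r s"
    by (rule open_mobius_bandE)
  then show "p \<in> mobius_strip R w"
    using assms by (auto simp: mobius_strip_def intro!: image_eqI[of _ _ "(r, s)"])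
qed

lemma mobius_dr_tangent:
  assumes "\<bar>s\<bar> < v"
  shows "mobius_dr R r s \<in> tangent_space (open_mobius_band R v) (mobius_param R r s)"
proof -
  have "((\<lambda>u. mobius_param R (r + u) s) has_vector_derivative mobius_dr R (r + u) s) (at u)" for u
  proof -
    have "((\<lambda>r. mobius_param R r s) \<circ> (\<lambda>u. r + u) has_vector_derivative 1 *\<^sub>R mobius_dr R (r + u) s) (at u)"
      by (rule vector_diff_chain_at)
        (auto intro!: derivative_eq_intros mobius_param_has_derivative_r)
    then show ?thesis by (simp add: o_def)
  qed
  moreover have "continuous_on {- 1<..<1} (\<lambda>u. mobius_dr R (r + u) s)"
    unfolding mobius_dr_def by (intro continuous_intros) auto
  ultimately show ?thesis
    unfolding tangent_space_def using assms
    by (intro CollectI exI[of _ 1] exI[of _ "\<lambda>u. mobius_param R (r + u) s"]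
        exI[of _ "\<lambda>u. mobius_dr R (r + u) s"] conjI ballI mobius_param_mem_band) auto
qed

lemma mobius_ds_tangent:
  assumes "\<bar>s\<bar> < v"
  shows "mobius_ds r \<in> tangent_space (open_mobius_band R v) (mobius_param R r s)"
proof -
  have "((\<lambda>u. mobius_param R r (s + u)) has_vector_derivative mobius_ds r) (at u)" for u
  proof -
    have "((\<lambda>s. mobius_param R r s) \<circ> (\<lambda>u. s + u) has_vector_derivative 1 *\<^sub>R mobius_ds r) (at u)"
      by (rule vector_diff_chain_at)
        (auto intro!: derivative_eq_intros mobius_param_has_derivative_s)
    then show ?thesis by (simp add: o_def)
  qed
  \<comment> \<open>The radius \<open>v - \<bar>s\<bar>\<close> is the distance from
    \<open>s\<close> to the edge of the band.\<close>
  then show ?thesis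
    unfolding tangent_space_def using assms
    by (intro CollectI exI[of _ "v - \<bar>s\<bar>"] exI[of _ "\<lambda>u. mobius_param R r (s + u)"]
        exI[of _ "\<lambda>u :: real. mobius_ds r"] conjI ballI mobius_param_mem_band) auto
qed

text \<open>Here \<open>R + s > R - w > 0\<close>, so the right side is at least the square of
  \<open>R - w\<close>, hence at least \<open>v\<close>, while \<open>s < v\<close>.\<close>

lemma no_characteristic_parameter:
  fixes s :: real
  assumes "v \<le> w" "w < R" "v \<le> (R - w)\<^sup>2" "\<bar>s\<bar> < v"
  shows "s \<noteq> (R + s)\<^sup>2"
proof -
  have "(R - w)\<^sup>2 \<le> (R + s)\<^sup>2"
    using assms by (intro power_mono) auto
  then show ?thesis
    using assms by linarith
qed

lemma characteristic_open_mobius_band: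
  assumes "v \<le> w" "w < R" "v \<le> (R - w)\<^sup>2"
  shows "characteristic_set (tangent_space (open_mobius_band R v)) (open_mobius_band R v) = {}"
proof -
  have False if p: "p \<in> open_mobius_band R v"
    and sub: "tangent_space (open_mobius_band R v) p \<subseteq> horizontal_space p" for p
  proof -
    obtain r s where rs: "r \<in> {0..<2 * pi}" "\<bar>s\<bar> < v" "p = mobius_param R r s"
      using p by (rule open_mobius_bandE)
    then have "s = (R + s)\<^sup>2"
      using mobius_horizontalD(2)[of r R s] sub mobius_dr_tangent[of s v R r]
        mobius_ds_tangent[of s v r R] by auto
    then show False
      using no_characteristic_parameter[OF assms rs(2)] by simp
  qed
  then show ?thesis
    by (auto simp: characteristic_set_def)
qed

section \<open>Non-orientability of the band\<close>

lemma open_mobius_band_not_orientable: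
  assumes "R > 0" "v > 0"
  shows "\<not> euclidean_orientable (open_mobius_band R v)"
proof
  let ?M = "open_mobius_band R v"
  assume "euclidean_orientable ?M"
  then obtain n where n: "continuous_on ?M n"
    "\<And>p. p \<in> ?M \<Longrightarrow> n p \<noteq> 0"
    "\<And>p u. p \<in> ?M \<Longrightarrow> u \<in> tangent_space ?M p \<Longrightarrow> n p \<bullet> u = 0"
    unfolding euclidean_orientable_def by blast
  \<comment> \<open>\<open>N r\<close> is the cross product of \<open>mobius_dr R r 0\<close>,
    divided by \<open>R\<close>, with \<open>mobius_ds r\<close>.\<close>
  define N :: "real \<Rightarrow> real ^ 3"
    where "N r = vector [sin (r / 2) * cos r, sin (r / 2) * sin r, - cos (r / 2)]" for r
  define f where "f r = n (mobius_param R r 0) \<bullet> N r" for r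
  have mem: "mobius_param R r 0 \<in> ?M" for r
    using assms by (intro mobius_param_mem_band) simp
  \<comment> \<open>A zero of \<open>f\<close> would make \<open>n\<close> orthogonal to an
    orthogonal basis.\<close>
  have nz: "f r \<noteq> 0" for r
  proof
    assume "f r = 0"
    define m where "m = n (mobius_param R r 0)"
    have "m \<bullet> mobius_dr R r 0 = 0" "m \<bullet> mobius_ds r = 0"
      unfolding m_def using assms
      by (auto intro!: n(3)[OF mem] mobius_dr_tangent mobius_ds_tangent)
    then have
      1: "m $ 2 * cos r - m $ 1 * sin r = 0" and
      2: "cos (r / 2) * (m $ 1 * cos r + m $ 2 * sin r) + m $ 3 * sin (r / 2) = 0" and
      3: "sin (r / 2) * (m $ 1 * cos r + m $ 2 * sin r) - m $ 3 * cos (r / 2) = 0"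
      using \<open>f r = 0\<close> assms
      by (auto simp: f_def m_def N_def inner_vec3 mobius_dr_def mobius_ds_def algebra_simps)
    have a: "m $ 1 * cos r + m $ 2 * sin r = 0" and b: "m $ 3 = 0"
      using 2 3 sin_cos_squared_add[of "r / 2"] by algebra+
    have "m $ 1 = 0" "m $ 2 = 0"
      using 1 a sin_cos_squared_add[of r] by algebra+
    with b have "m = 0"
      by (intro vec3_eqI) auto
    then show False
      using n(2)[OF mem] by (simp add: m_def)
  qed
  have "continuous_on {0..2 * pi} (\<lambda>r. mobius_param R r 0)"
    unfolding mobius_param_def by (intro continuous_intros) auto
  then have "continuous_on {0..2 * pi} (\<lambda>r. n (mobius_param R r 0))"
    by (rule continuous_on_compose2[OF n(1)]) (use mem in auto)
  then have cont: "continuous_on {0..2 * pi} f"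
    unfolding f_def N_def
    by (intro continuous_intros) auto
  \<comment> \<open>After one turn the core circle closes up, but the half angle has grown by pi,
    which reverses \<open>N\<close>.\<close>
  have "N (2 * pi) = - N 0"
    by (rule vec3_eqI) (simp_all add: N_def)
  moreover have "mobius_param R (2 * pi) 0 = mobius_param R 0 0"
    by (simp add: mobius_param_def)
  ultimately have sign: "f (2 * pi) = - f 0"
    by (simp add: f_def)
  have "\<exists>r. 0 \<le> r \<and> r \<le> 2 * pi \<and> f r = 0"
  proof (cases "f 0 \<le> 0")
    case True
    then show ?thesis using IVT'[of f 0 0 "2 * pi"] cont sign by auto
  next
    case False
    then show ?thesis using IVT2'[of f "2 * pi" 0 0] cont sign by auto
  qed
  then show False
    using nz by blast
qed

section \<open>Cylindrical radius and half-angle functions\<close>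

definition cyl_radius :: "real ^ 3 \<Rightarrow> real" where
  "cyl_radius q = sqrt ((q $ 1)\<^sup>2 + (q $ 2)\<^sup>2)"

definition cyl_radius_grad :: "real ^ 3 \<Rightarrow> real ^ 3" where
  "cyl_radius_grad q = vector [q $ 1 / cyl_radius q, q $ 2 / cyl_radius q, 0]"

lemma cyl_radius_sq: "(cyl_radius q)\<^sup>2 = (q $ 1)\<^sup>2 + (q $ 2)\<^sup>2"
  by (simp add: cyl_radius_def)

text \<open>On the vertical axis the radius and \<open>q $ 1\<close> both vanish, so a positive
  denominator of \<open>half_angle\<close> keeps \<open>q\<close> where \<open>cyl_radius\<close> is
  differentiable.\<close>

lemma cyl_radius_pos:
  assumes "cyl_radius q + e * q $ 1 > 0"
  shows "cyl_radius q > 0"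
proof -
  have "q $ 1 = 0" if "cyl_radius q = 0"
    using cyl_radius_sq[of q] that by (simp add: sum_power2_eq_zero_iff)
  moreover have "cyl_radius q \<ge> 0"
    by (simp add: cyl_radius_def)
  ultimately show ?thesis
    using assms by force
qed

lemma has_derivative_vec_nth: "((\<lambda>q :: real ^ 3. q $ i) has_derivative (\<lambda>h. h $ i)) F"
  by (rule bounded_linear_imp_has_derivative) (rule bounded_linear_vec_nth)

lemma GDERIV_cyl_radius:
  assumes "cyl_radius q > 0"
  shows "GDERIV cyl_radius q :> cyl_radius_grad q"
proof -
  have pos: "(q $ 1)\<^sup>2 + (q $ 2)\<^sup>2 > 0"
    using assms by (simp add: cyl_radius_def)
  have "(cyl_radius has_derivative
      (\<lambda>h. (2 * q $ 1 * h $ 1 + 2 * q $ 2 * h $ 2) / (2 * cyl_radius q))) (at q)"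
    unfolding cyl_radius_def[abs_def] using pos
    by (auto intro!: derivative_eq_intros has_derivative_vec_nth simp: field_simps)
  moreover have "(2 * q $ 1 * h $ 1 + 2 * q $ 2 * h $ 2) / (2 * cyl_radius q)
      = h \<bullet> cyl_radius_grad q" for h
    using assms by (simp add: cyl_radius_grad_def inner_vec3 field_simps)
  ultimately show ?thesis
    by (simp add: gderiv_def)
qed

text \<open>The half-angle functions \<open>tan (\<theta> / 2)\<close> for \<open>e = 1\<close> and \<open>cot (\<theta> / 2)\<close> for \<open>e = -1\<close>.\<close>

definition half_angle :: "real \<Rightarrow> real ^ 3 \<Rightarrow> real" where
  "half_angle e q = q $ 2 / (cyl_radius q + e * q $ 1)"

definition half_angle_grad :: "real \<Rightarrow> real ^ 3 \<Rightarrow> real ^ 3" where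
  "half_angle_grad e q =
     vector [- q $ 2 * (q $ 1 / cyl_radius q + e) / (cyl_radius q + e * q $ 1)\<^sup>2,
             1 / (cyl_radius q + e * q $ 1)
               - q $ 2 * (q $ 2 / cyl_radius q) / (cyl_radius q + e * q $ 1)\<^sup>2, 0]"

lemma GDERIV_half_angle:
  assumes "cyl_radius q + e * q $ 1 > 0"
  shows "GDERIV (half_angle e) q :> half_angle_grad e q"
proof -
  have "(cyl_radius has_derivative (\<lambda>h. h \<bullet> cyl_radius_grad q)) (at q)"
    using GDERIV_cyl_radius[OF cyl_radius_pos[OF assms]] by (simp add: gderiv_def)
  then have "((\<lambda>q. q $ 2 / (cyl_radius q + e * q $ 1)) has_derivative
      (\<lambda>h. (h $ 2 * (cyl_radius q + e * q $ 1) - q $ 2 * (h \<bullet> cyl_radius_grad q + e * h $ 1))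
        / (cyl_radius q + e * q $ 1)\<^sup>2)) (at q)"
    using assms
    by (auto intro!: derivative_eq_intros has_derivative_vec_nth simp: power2_eq_square)
  moreover have "(h $ 2 * d - q $ 2 * (h \<bullet> cyl_radius_grad q + e * h $ 1)) / d\<^sup>2
      = h \<bullet> half_angle_grad e q" if "d = cyl_radius q + e * q $ 1" for h d
  proof -
    have "d \<noteq> 0"
      using assms that by simp
    then show ?thesis
      using cyl_radius_pos[OF assms]
      by (simp add: inner_vec3 cyl_radius_grad_def half_angle_grad_def flip: that)
        (simp add: field_simps power2_eq_square)
  qed
  ultimately show ?thesis
    unfolding gderiv_def half_angle_def[abs_def] by simp
qed

lemma continuous_on_cyl_radius [continuous_intros]: "continuous_on S cyl_radius"
  unfolding cyl_radius_def[abs_def] by (intro continuous_intros)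

lemma continuous_on_cyl_radius_grad:
  assumes "\<And>q. q \<in> S \<Longrightarrow> cyl_radius q > 0"
  shows "continuous_on S cyl_radius_grad"
  unfolding cyl_radius_grad_def[abs_def]
  using assms by (intro continuous_intros) force+

lemma continuous_on_half_angle:
  assumes "\<And>q. q \<in> S \<Longrightarrow> cyl_radius q + e * q $ 1 > 0"
  shows "continuous_on S (half_angle e)" "continuous_on S (half_angle_grad e)"
proof -
  have "cyl_radius q + e * q $ 1 \<noteq> 0" "cyl_radius q \<noteq> 0" if "q \<in> S" for q
    using cyl_radius_pos[OF assms[OF that]] assms[OF that] by auto
  then show "continuous_on S (half_angle e)" "continuous_on S (half_angle_grad e)"
    unfolding half_angle_def[abs_def] half_angle_grad_def[abs_def]
    by (intro continuous_intros; simp)+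
qed

text \<open>Euler's identity for a function positively homogeneous of degree 0 in
  \<open>q $ 1\<close> and \<open>q $ 2\<close>; the numerator cancels by
  \<open>cyl_radius_sq\<close>.\<close>

lemma half_angle_grad_radial:
  assumes "cyl_radius q + e * q $ 1 > 0"
  shows "q $ 1 * half_angle_grad e q $ 1 + q $ 2 * half_angle_grad e q $ 2 = 0"
proof -
  define a where "a = cyl_radius q"
  have a: "a > 0" "a + e * q $ 1 > 0" "a\<^sup>2 = (q $ 1)\<^sup>2 + (q $ 2)\<^sup>2"
    using cyl_radius_pos[OF assms(1)] assms(1) cyl_radius_sq[of q] by (auto simp: a_def)
  define d where "d = a + e * q $ 1"
  have "q $ 1 * (- q $ 2 * (q $ 1 / a + e) / d\<^sup>2) + q $ 2 * (1 / d - q $ 2 * (q $ 2 / a) / d\<^sup>2)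
      = q $ 2 * (d * a - ((q $ 1)\<^sup>2 + (q $ 2)\<^sup>2) - e * q $ 1 * a) / (a * d\<^sup>2)"
    using a by (simp add: d_def[symmetric] field_simps power2_eq_square)
  also have "\<dots> = 0"
    using a(3) by (simp add: d_def power2_eq_square algebra_simps)
  finally show ?thesis
    by (simp add: half_angle_grad_def a_def d_def)
qed

text \<open>The term \<open>s * cos (r / 2)\<close> is smaller in size than \<open>R\<close>, so the
  square root returns the radial factor itself and not its negative.\<close>

lemma cyl_radius_mobius_param:
  assumes "\<bar>s\<bar> < R"
  shows "cyl_radius (mobius_param R r s) = R + s * cos (r / 2)" "R + s * cos (r / 2) > 0"
proof -
  have "\<bar>s * cos (r / 2)\<bar> \<le> \<bar>s\<bar> * 1"
    unfolding abs_mult by (intro mult_left_mono) auto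
  then show pos: "R + s * cos (r / 2) > 0"
    using assms by linarith
  have "(R + s * cos (r / 2))\<^sup>2 * ((cos r)\<^sup>2 + (sin r)\<^sup>2) = (R + s * cos (r / 2))\<^sup>2"
    by simp
  then show "cyl_radius (mobius_param R r s) = R + s * cos (r / 2)"
    using pos by (simp add: cyl_radius_def mobius_param_def power_mult_distrib flip: distrib_left)
qed

text \<open>The angle \<open>r\<close> need not be normalised: a full turn flips the signs of
  \<open>sin (r / 2)\<close> and \<open>cos (r / 2)\<close> but preserves their squares and
  quotients.\<close>

lemma half_angle_polar:
  assumes "q $ 1 = cyl_radius q * cos r" "q $ 2 = cyl_radius q * sin r"
  shows "cyl_radius q + q $ 1 = 2 * cyl_radius q * (cos (r / 2))\<^sup>2"
    and "cyl_radius q - q $ 1 = 2 * cyl_radius q * (sin (r / 2))\<^sup>2"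
    and "cyl_radius q + q $ 1 > 0 \<Longrightarrow> half_angle 1 q = sin (r / 2) / cos (r / 2)"
    and "cyl_radius q - q $ 1 > 0 \<Longrightarrow> half_angle (- 1) q = cos (r / 2) / sin (r / 2)"
proof -
  have c: "cos r = 2 * (cos (r / 2))\<^sup>2 - 1" "cos r = 1 - 2 * (sin (r / 2))\<^sup>2"
    and s: "sin r = 2 * sin (r / 2) * cos (r / 2)"
    using cos_double_cos[of "r / 2"] cos_double_sin[of "r / 2"] sin_double[of "r / 2"]
      sin_squared_eq[of "r / 2"] by auto
  show 1: "cyl_radius q + q $ 1 = 2 * cyl_radius q * (cos (r / 2))\<^sup>2"
    unfolding assms(1) c(1) by (simp add: algebra_simps)
  show 2: "cyl_radius q - q $ 1 = 2 * cyl_radius q * (sin (r / 2))\<^sup>2"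
    unfolding assms(1) c(2) by (simp add: algebra_simps)
  show "half_angle 1 q = sin (r / 2) / cos (r / 2)" if "cyl_radius q + q $ 1 > 0"
    using that unfolding half_angle_def mult_1 1 assms(2) s
    by (auto simp: power2_eq_square)
  show "half_angle (- 1) q = cos (r / 2) / sin (r / 2)" if "cyl_radius q - q $ 1 > 0"
    using that 2 unfolding half_angle_def assms(2) s
    by (auto simp: power2_eq_square)
qed

lemma polar_cyl_radius:
  obtains r where "q $ 1 = cyl_radius q * cos r" "q $ 2 = cyl_radius q * sin r"
proof -
  obtain a r where ar: "q $ 1 = a * cos r" "q $ 2 = a * sin r"
    using polar_Ex[of "q $ 1" "q $ 2"] by blast
  have "(q $ 1)\<^sup>2 + (q $ 2)\<^sup>2 = a\<^sup>2"
    unfolding ar by (simp add: power_mult_distrib flip: distrib_left)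
  then have "cyl_radius q = \<bar>a\<bar>"
    by (simp add: cyl_radius_def)
  \<comment> \<open>The radius \<open>a\<close> may be negative, in which case the angle is shifted
    by pi.\<close>
  then show ?thesis
    using that[of r] that[of "r + pi"] ar by (cases "a \<ge> 0") auto
qed

section \<open>Local equations of the band\<close>

text \<open>On the band the left side equals the square of \<open>s\<close>, so this turns the bound
  on \<open>s\<close> into an open condition on points.\<close>

definition solid_torus :: "real \<Rightarrow> real \<Rightarrow> (real ^ 3) set" where
  "solid_torus R v = {q. (cyl_radius q - R)\<^sup>2 + (q $ 3)\<^sup>2 < v\<^sup>2}"

lemma open_solid_torus: "open (solid_torus R v)"
  unfolding solid_torus_def by (intro open_Collect_less continuous_intros)

text \<open>The equation makes \<open>(cyl_radius q - R, q $ 3)\<close> parallel to the unit vector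
  \<open>(cos (r / 2), sin (r / 2))\<close>; the parameter \<open>s\<close> is its component along
  that vector.\<close>

lemma open_mobius_bandI:
  assumes "q $ 1 = cyl_radius q * cos r" "q $ 2 = cyl_radius q * sin r" "q \<in> solid_torus R v" "v > 0"
    and "(cyl_radius q - R) * sin (r / 2) = q $ 3 * cos (r / 2)"
  shows "q \<in> open_mobius_band R v"
proof -
  define s where "s = (cyl_radius q - R) * cos (r / 2) + q $ 3 * sin (r / 2)"
  have c: "s * cos (r / 2) = cyl_radius q - R" and t: "s * sin (r / 2) = q $ 3"
    using assms(5) sin_cos_squared_add[of "r / 2"] unfolding s_def by algebra+
  have "s\<^sup>2 = (s * cos (r / 2))\<^sup>2 + (s * sin (r / 2))\<^sup>2"
    by (simp add: power_mult_distrib flip: distrib_left)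
  then have "s\<^sup>2 < v\<^sup>2"
    using assms(3) unfolding c t solid_torus_def by simp
  then have "\<bar>s\<bar> < v"
    using assms(4) power2_less_imp_less[of "\<bar>s\<bar>" v] by simp
  moreover have "q = mobius_param R r s"
    by (rule vec3_eqI) (simp_all add: mobius_param_def c t assms(1,2))
  ultimately show ?thesis
    by (auto simp: open_mobius_band_def)
qed

lemma C1_surface_chartI:
  assumes "open U" "p \<in> U" "\<And>q. q \<in> U \<Longrightarrow> GDERIV g q :> G q" "continuous_on U G"
    "\<And>q. q \<in> U \<Longrightarrow> q \<in> S \<longleftrightarrow> g q = 0" "\<And>q. q \<in> U \<Longrightarrow> G q \<noteq> 0"
  shows "\<exists>U g G. open U \<and> p \<in> U \<and> (\<forall>q\<in>U. GDERIV g q :> G q) \<and> continuous_on U G \<and>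
    S \<inter> U = {q \<in> U. g q = 0} \<and> (\<forall>q\<in>U. G q \<noteq> 0)"
  using assms by (intro exI[of _ U] exI[of _ g] exI[of _ G]) auto

lemma open_half_angle_domain: "open {q. cyl_radius q + e * q $ 1 > 0}"
  by (intro open_Collect_less continuous_intros)

lemma GDERIV_height: "GDERIV (\<lambda>q :: real ^ 3. q $ 3) q :> axis 3 1"
  unfolding gderiv_def by (rule has_derivative_eq_rhs[OF has_derivative_vec_nth])
    (simp add: inner_axis fun_eq_iff)

lemma GDERIV_cyl_radius_diff:
  assumes "cyl_radius q > 0"
  shows "GDERIV (\<lambda>q. cyl_radius q - R) q :> cyl_radius_grad q"
  using GDERIV_diff[OF GDERIV_cyl_radius[OF assms] GDERIV_const[of R]] by simp

text \<open>Since \<open>cos (r / 2)\<close> and \<open>sin (r / 2)\<close> have no common zero, the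
  equation in \<open>open_mobius_bandI\<close> can be divided by one of them near every
  point.\<close>

lemma open_mobius_band_surface:
  assumes "0 < v" "v < R"
  shows "C1_euclidean_surface (open_mobius_band R v)"
  unfolding C1_euclidean_surface_def
proof
  let ?M = "open_mobius_band R v"
  have param: "mobius_param R r s $ 1 = cyl_radius (mobius_param R r s) * cos r"
    "mobius_param R r s $ 2 = cyl_radius (mobius_param R r s) * sin r"
    "mobius_param R r s $ 3 = s * sin (r / 2)"
    "cyl_radius (mobius_param R r s) - R = s * cos (r / 2)"
    "cyl_radius (mobius_param R r s) > 0"
    if "\<bar>s\<bar> < v" for r s
    using cyl_radius_mobius_param[of s R r] that assms by (auto simp: mobius_param_def)
  have torus: "?M \<subseteq> solid_torus R v"
  proof
    fix q assume "q \<in> ?M"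
    then obtain r s where rs: "\<bar>s\<bar> < v" "q = mobius_param R r s"
      by (auto simp: open_mobius_band_def)
    have "(s * cos (r / 2))\<^sup>2 + (s * sin (r / 2))\<^sup>2 = s\<^sup>2"
      by (simp add: power_mult_distrib flip: distrib_left)
    also have "\<dots> < v\<^sup>2"
      using power_strict_mono[OF rs(1), of 2] by simp
    finally show "q \<in> solid_torus R v"
      unfolding solid_torus_def using param[OF rs(1)] by (simp add: rs(2))
  qed
  fix p assume p: "p \<in> ?M"
  obtain r s where rs: "\<bar>s\<bar> < v" "p = mobius_param R r s"
    using p by (auto simp: open_mobius_band_def)
  show "\<exists>U g G. open U \<and> p \<in> U \<and> (\<forall>q\<in>U. GDERIV g q :> G q) \<and> continuous_on U G \<and>
    ?M \<inter> U = {q \<in> U. g q = 0} \<and> (\<forall>q\<in>U. G q \<noteq> 0)"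
  proof (cases "cos (r / 2) = 0")
    case False
    \<comment> \<open>This omits the half-plane \<open>y = 0\<close>, \<open>x <= 0\<close>, where
      the denominator of \<open>half_angle 1\<close> vanishes.\<close>
    let ?U = "solid_torus R v \<inter> {q. cyl_radius q + 1 * q $ 1 > 0}"
    let ?g = "\<lambda>q. (cyl_radius q - R) * half_angle 1 q - q $ 3"
    let ?G = "\<lambda>q. (cyl_radius q - R) *\<^sub>R half_angle_grad 1 q
      + half_angle 1 q *\<^sub>R cyl_radius_grad q - axis 3 1"
    have dom: "cyl_radius q + 1 * q $ 1 > 0" "cyl_radius q > 0" if "q \<in> ?U" for q
      using that cyl_radius_pos[of q 1] by auto
    show ?thesis
    proof (rule C1_surface_chartI[of ?U p ?g ?G])
      show "open ?U"
        by (intro open_Int open_solid_torus open_half_angle_domain)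
      show "p \<in> ?U"
        using half_angle_polar(1)[OF param(1,2)[OF rs(1), of r]] param(5)[OF rs(1), of r] False torus p
        by (auto simp: rs(2))
      show "GDERIV ?g q :> ?G q" if "q \<in> ?U" for q
        using dom[OF that]
        by (intro GDERIV_diff GDERIV_mult GDERIV_half_angle GDERIV_cyl_radius_diff GDERIV_height)
      show "continuous_on ?U ?G"
        using dom by (intro continuous_intros continuous_on_half_angle continuous_on_cyl_radius_grad) blast+
      \<comment> \<open>Neither the radius nor the half angle depends on the height, which leaves
        only the term \<open>- q $ 3\<close>.\<close>
      have "?G q $ 3 = - 1" for q
        by (simp add: half_angle_grad_def cyl_radius_grad_def axis_def)
      then show "?G q \<noteq> 0" for q
        by (metis zero_index zero_neq_neg_one)
      show "q \<in> ?M \<longleftrightarrow> ?g q = 0" if q: "q \<in> ?U" for q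
      proof
        assume "q \<in> ?M"
        then obtain r s where rs: "\<bar>s\<bar> < v" "q = mobius_param R r s"
          by (auto simp: open_mobius_band_def)
        note pol = half_angle_polar[OF param(1,2)[OF rs(1), of r]]
        have "cos (r / 2) \<noteq> 0" "half_angle 1 q = sin (r / 2) / cos (r / 2)"
          using pol(1,3) dom[OF q] by (auto simp: rs(2))
        then show "?g q = 0"
          using param(3,4)[OF rs(1), of r] by (simp add: rs(2))
      next
        assume g: "?g q = 0"
        obtain r where r: "q $ 1 = cyl_radius q * cos r" "q $ 2 = cyl_radius q * sin r"
          by (rule polar_cyl_radius)
        have "cos (r / 2) \<noteq> 0" "half_angle 1 q = sin (r / 2) / cos (r / 2)"
          using half_angle_polar(1,3)[OF r] dom[OF q] by auto
        moreover have "q $ 3 = (cyl_radius q - R) * half_angle 1 q"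
          using g by simp
        ultimately have "(cyl_radius q - R) * sin (r / 2) = q $ 3 * cos (r / 2)"
          by simp
        then show "q \<in> ?M"
          using open_mobius_bandI[OF r] q assms by blast
      qed
    qed
  next
    case True
    then have sin: "sin (r / 2) \<noteq> 0"
      using sin_cos_squared_add[of "r / 2"] by force
    \<comment> \<open>The omitted half-plane is now \<open>y = 0\<close>, \<open>x >= 0\<close>, and
      the equation has been divided by the sine.\<close>
    let ?U = "solid_torus R v \<inter> {q. cyl_radius q + (- 1) * q $ 1 > 0}"
    let ?g = "\<lambda>q. (cyl_radius q - R) - q $ 3 * half_angle (- 1) q"
    let ?G = "\<lambda>q. cyl_radius_grad q
      - (q $ 3 *\<^sub>R half_angle_grad (- 1) q + half_angle (- 1) q *\<^sub>R axis 3 1)"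
    have dom: "cyl_radius q + (- 1) * q $ 1 > 0" "cyl_radius q > 0" if "q \<in> ?U" for q
      using that cyl_radius_pos[of q "- 1"] by auto
    show ?thesis
    proof (rule C1_surface_chartI[of ?U p ?g ?G])
      show "open ?U"
        by (intro open_Int open_solid_torus open_half_angle_domain)
      have "cyl_radius p - p $ 1 > 0"
        using half_angle_polar(2)[OF param(1,2)[OF rs(1), of r]] param(5)[OF rs(1), of r] sin
        by (simp only: rs(2)) simp
      then show "p \<in> ?U"
        using torus p by auto
      show "GDERIV ?g q :> ?G q" if "q \<in> ?U" for q
        using dom[OF that]
        by (intro GDERIV_diff GDERIV_mult GDERIV_half_angle GDERIV_cyl_radius_diff GDERIV_height)
      show "continuous_on ?U ?G"
        using dom by (intro continuous_intros continuous_on_half_angle continuous_on_cyl_radius_grad) blast+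
      \<comment> \<open>The half-angle is homogeneous of degree 0, so only the radius varies along a radius.\<close>
      show "?G q \<noteq> 0" if q: "q \<in> ?U" for q
      proof
        assume "?G q = 0"
        then have "?G q $ 1 = 0" "?G q $ 2 = 0"
          by (simp_all only: zero_index)
        then have "q $ 1 * cyl_radius_grad q $ 1 + q $ 2 * cyl_radius_grad q $ 2
          = q $ 3 * (q $ 1 * half_angle_grad (- 1) q $ 1 + q $ 2 * half_angle_grad (- 1) q $ 2)"
          by (simp add: axis_def algebra_simps)
        then have "q $ 1 * cyl_radius_grad q $ 1 + q $ 2 * cyl_radius_grad q $ 2 = 0"
          using half_angle_grad_radial[OF dom(1)[OF q]] by simp
        then have "(cyl_radius q)\<^sup>2 = 0"
          unfolding cyl_radius_sq using dom(2)[OF q]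
          by (simp add: cyl_radius_grad_def field_simps power2_eq_square)
        then show False
          using dom(2)[OF q] by simp
      qed
      show "q \<in> ?M \<longleftrightarrow> ?g q = 0" if q: "q \<in> ?U" for q
      proof
        assume "q \<in> ?M"
        then obtain r s where rs: "\<bar>s\<bar> < v" "q = mobius_param R r s"
          by (auto simp: open_mobius_band_def)
        note pol = half_angle_polar[OF param(1,2)[OF rs(1), of r]]
        have "sin (r / 2) \<noteq> 0" "half_angle (- 1) q = cos (r / 2) / sin (r / 2)"
          using pol(2,4) dom[OF q] by (auto simp: rs(2))
        then show "?g q = 0"
          using param(3,4)[OF rs(1), of r] by (simp add: rs(2))
      next
        assume g: "?g q = 0"
        obtain r where r: "q $ 1 = cyl_radius q * cos r" "q $ 2 = cyl_radius q * sin r"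
          by (rule polar_cyl_radius)
        have "sin (r / 2) \<noteq> 0" "half_angle (- 1) q = cos (r / 2) / sin (r / 2)"
          using half_angle_polar(2,4)[OF r] dom[OF q] by auto
        moreover have "cyl_radius q - R = q $ 3 * half_angle (- 1) q"
          using g by simp
        ultimately have "(cyl_radius q - R) * sin (r / 2) = q $ 3 * cos (r / 2)"
          by simp
        then show "q \<in> ?M"
          using open_mobius_bandI[OF r] q assms by blast
      qed
    qed
  qed
qed

section \<open>The closed strip and the open band inside it\<close>

theorem proposition2p6:
  fixes R w :: real
  assumes "R > 0" and "0 < w" and "w < R"
  shows "(\<forall>p \<in> characteristic_set (mobius_tangent_space R w) (mobius_strip R w).
          \<forall>q \<in> characteristic_set (mobius_tangent_space R w) (mobius_strip R w). p = q) \<and>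
    (\<exists>M'. C1_euclidean_surface M' \<and> M' \<subseteq> mobius_strip R w \<and>
       (\<forall>p \<in> characteristic_set (mobius_tangent_space R w) (mobius_strip R w). p \<notin> M') \<and>
       \<not> euclidean_orientable M' \<and>
       characteristic_set (tangent_space M') M' = {})"
proof (intro conjI ballI exI)
  let ?C = "characteristic_set (mobius_tangent_space R w) (mobius_strip R w)"
  \<comment> \<open>The bound \<open>w\<close> keeps the band inside the strip; the square keeps the
    roots of the quadratic equation out of the band.\<close>
  define v where "v = min w ((R - w)\<^sup>2)"
  have v: "0 < v" "v \<le> w" "v < R" "v \<le> (R - w)\<^sup>2"
    using assms by (auto simp: v_def)
  show "p = q" if "p \<in> ?C" "q \<in> ?C" for p q
    using that assms characteristic_parameter_unique by (metis characteristic_mobius_stripE)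
  show "C1_euclidean_surface (open_mobius_band R v)"
    using v by (intro open_mobius_band_surface)
  show "open_mobius_band R v \<subseteq> mobius_strip R w"
    using v by (intro open_mobius_band_subset)
  show "p \<notin> open_mobius_band R v" if p: "p \<in> ?C" for p
  proof
    assume "p \<in> open_mobius_band R v"
    then obtain r s where rs: "r \<in> {0..<2 * pi}" "\<bar>s\<bar> < v" "p = mobius_param R r s"
      by (rule open_mobius_bandE)
    obtain s' where s': "\<bar>s'\<bar> \<le> w" "p = mobius_param R 0 s'" "s' = (R + s')\<^sup>2"
      using p assms by (blast elim: characteristic_mobius_stripE)
    \<comment> \<open>Both parameter pairs lie in the domain of injectivity, so the root
      \<open>s'\<close> would be the parameter \<open>s\<close> with
      \<open>\<bar>s\<bar> < v\<close>.\<close>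
    have "(r, s) = (0, s')"
      by (rule inj_onD[OF inj_on_mobius_param[OF assms(2,3)]]) (use rs s' v in auto)
    then show False
      using no_characteristic_parameter[OF v(2) assms(3) v(4) rs(2)] s' by auto
  qed
  show "\<not> euclidean_orientable (open_mobius_band R v)"
    using assms v by (intro open_mobius_band_not_orientable)
  show "characteristic_set (tangent_space (open_mobius_band R v)) (open_mobius_band R v) = {}"
    using assms v by (intro characteristic_open_mobius_band)
qed

end
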